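(* Let $d\in\mathbb{N}$, let $\Omega\subset\mathbb{C}^d$ be a nonempty open set, and let $\mathcal{X}\subset\operatorname{Hol}(\Omega)$ be a metrizable topological vector space satisfying properties P1, P2, P3 (see context). Then $\Omega_{max}$ is an $F_\sigma$ subset of $\mathbb{C}^d$, i.e. a countable union of closed sets.
   Context: All vector spaces are over $\mathbb{C}$; topological vector spaces are not assumed locally convex. Metrizable means that the topology of $\mathcal{X}$ is induced by a translation-invariant metric (completeness is not assumed). $\operatorname{Hol}(\Omega)$ is the space of holomorphic functions on $\Omega$. $\mathcal{P}_d$ is the set of polynomials in $d$ complex variables, viewed (by restriction) as functions on $\Omega$. The properties are: P1: $\mathcal{P}_d\subset\mathcal{X}$ and $\mathcal{P}_d$ is dense in $\mathcal{X}$. P2: for each $w\in\Omega$ the evaluation functional $\Lambda_w(F)=F(w)$, $F\in\mathcal{X}$, is continuous. P3: for each $1\le j\le d$ the shift operator $S_jF(z)=z_jF(z)$ maps $\mathcal{X}$ to $\mathcal{X}$ and is continuous. Maximal domain: $\Omega_{max}$ is the set of all $w\in\mathbb{C}^d$ such that the functional $P\mapsto P(w)$ on $\mathcal{P}_d$ extends to a continuous linear functional on $\mathcal{X}$. *)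

theory Defs
  imports "HOL-Analysis.Analysis"
begin

text \<open>
  \<open>\<complex>\<^sup>d\<close> is \<open>complex ^ 'd\<close> with \<open>d = CARD('d)\<close>. A function on \<open>\<Omega>\<close> is represented by its
  extension by 0 to all of \<open>\<complex>\<^sup>d\<close>, so that equality of representatives is equality on \<open>\<Omega>\<close> and
  the vector space operations are the pointwise ones.
\<close>

definition restrict_zero :: "'a set \<Rightarrow> ('a \<Rightarrow> complex) \<Rightarrow> 'a \<Rightarrow> complex" where
  "restrict_zero \<Omega> f = (\<lambda>z. if z \<in> \<Omega> then f z else 0)"

text \<open>Holomorphic means complex (Frechet) differentiable: the real derivative is complex linear.\<close>

definition Hol :: "(complex ^ 'd) set \<Rightarrow> (complex ^ 'd \<Rightarrow> complex) set" where
  "Hol \<Omega> = {f. (\<forall>z\<in>\<Omega>. \<exists>D. (f has_derivative D) (at z) \<and> Vector_Spaces.linear (*s) (*) D)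
              \<and> (\<forall>z. z \<notin> \<Omega> \<longrightarrow> f z = 0)}"

definition polys :: "(complex ^ 'd \<Rightarrow> complex) set" where
  "polys = {p. \<exists>(A :: ('d \<Rightarrow> nat) set) c. finite A \<and>
                 p = (\<lambda>z. \<Sum>\<alpha>\<in>A. c \<alpha> * (\<Prod>j\<in>UNIV. (z $ j) ^ \<alpha> j))}"

text \<open>
  The topology carries its underlying space as \<open>topspace T\<close>; closure under the operations is
  part of \<open>continuous_map\<close>.
\<close>

definition function_tvs :: "('a \<Rightarrow> complex) topology \<Rightarrow> bool" where
  "function_tvs T \<longleftrightarrow>
     (\<lambda>z. 0) \<in> topspace T \<and>
     continuous_map (prod_topology T T) T (\<lambda>(F, G). \<lambda>z. F z + G z) \<and>
     continuous_map (prod_topology euclidean T) T (\<lambda>(c, F). \<lambda>z. c * F z)"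

definition invariantly_metrizable :: "('a \<Rightarrow> complex) topology \<Rightarrow> bool" where
  "invariantly_metrizable T \<longleftrightarrow>
     (\<exists>\<rho>. Metric_space (topspace T) \<rho> \<and> T = Metric_space.mtopology (topspace T) \<rho> \<and>
          (\<forall>F\<in>topspace T. \<forall>G\<in>topspace T. \<forall>H\<in>topspace T.
             \<rho> (\<lambda>z. F z + H z) (\<lambda>z. G z + H z) = \<rho> F G))"

definition property_P1 ::
    "(complex ^ 'd) set \<Rightarrow> (complex ^ 'd \<Rightarrow> complex) topology \<Rightarrow> bool" where
  "property_P1 \<Omega> T \<longleftrightarrow>
     restrict_zero \<Omega> ` polys \<subseteq> topspace T \<and>
     T closure_of (restrict_zero \<Omega> ` polys) = topspace T"

definition property_P2 ::
    "(complex ^ 'd) set \<Rightarrow> (complex ^ 'd \<Rightarrow> complex) topology \<Rightarrow> bool" where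
  "property_P2 \<Omega> T \<longleftrightarrow> (\<forall>w\<in>\<Omega>. continuous_map T euclidean (\<lambda>F. F w))"

definition property_P3 :: "(complex ^ 'd \<Rightarrow> complex) topology \<Rightarrow> bool" where
  "property_P3 T \<longleftrightarrow> (\<forall>j. continuous_map T T (\<lambda>F. \<lambda>z. z $ j * F z))"

definition continuous_linear_functional ::
    "('a \<Rightarrow> complex) topology \<Rightarrow> (('a \<Rightarrow> complex) \<Rightarrow> complex) \<Rightarrow> bool" where
  "continuous_linear_functional T L \<longleftrightarrow>
     continuous_map T euclidean L \<and>
     (\<forall>F\<in>topspace T. \<forall>G\<in>topspace T. L (\<lambda>z. F z + G z) = L F + L G) \<and>
     (\<forall>c. \<forall>F\<in>topspace T. L (\<lambda>z. c * F z) = c * L F)"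

definition maximal_domain ::
    "(complex ^ 'd) set \<Rightarrow> (complex ^ 'd \<Rightarrow> complex) topology \<Rightarrow> (complex ^ 'd) set" where
  "maximal_domain \<Omega> T =
     {w. \<exists>L. continuous_linear_functional T L \<and> (\<forall>p\<in>polys. L (restrict_zero \<Omega> p) = p w)}"

end

theory Submission
  imports Defs
begin

text \<open>
  If \<open>V n\<close> are the balls of radius \<open>1 / (n + 1)\<close> about the origin of \<open>\<X>\<close>, evaluation of
  polynomials at \<open>w\<close> extends continuously to \<open>\<X>\<close> iff for some \<open>n\<close> every polynomial \<open>p\<close> in
  \<open>V n\<close> satisfies \<open>\<bar>p w\<bar> \<le> 1\<close>: a linear functional bounded near the origin of a dense subspace
  is uniformly continuous. For fixed \<open>n\<close> this condition on \<open>w\<close> is closed, since polynomials are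
  continuous.
\<close>

section \<open>Polynomials, their restrictions and their linear structure\<close>

lemma polys_add:
  assumes "p \<in> polys" "q \<in> polys"
  shows "(\<lambda>z. p z + q z) \<in> polys"
proof -
  obtain A c where A: "finite (A :: ('a \<Rightarrow> nat) set)"
      "p = (\<lambda>z. \<Sum>\<alpha>\<in>A. c \<alpha> * (\<Prod>j\<in>UNIV. (z $ j) ^ \<alpha> j))"
    using assms(1) unfolding polys_def by blast
  obtain B b where B: "finite (B :: ('a \<Rightarrow> nat) set)"
      "q = (\<lambda>z. \<Sum>\<alpha>\<in>B. b \<alpha> * (\<Prod>j\<in>UNIV. (z $ j) ^ \<alpha> j))"
    using assms(2) unfolding polys_def by blast
  \<comment> \<open>Both coefficient families are extended by 0 to the common index set
    \<open>A \<union> B\<close>; the added terms vanish, and exponents lying in both sets get the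
    sum of their coefficients.\<close>
  define e where "e \<alpha> = (if \<alpha> \<in> A then c \<alpha> else 0) + (if \<alpha> \<in> B then b \<alpha> else 0)" for \<alpha>
  have "p z + q z = (\<Sum>\<alpha>\<in>A \<union> B. e \<alpha> * (\<Prod>j\<in>UNIV. (z $ j) ^ \<alpha> j))" for z
  proof -
    have "p z = (\<Sum>\<alpha>\<in>A \<union> B. (if \<alpha> \<in> A then c \<alpha> else 0) * (\<Prod>j\<in>UNIV. (z $ j) ^ \<alpha> j))"
      unfolding A(2) using A(1) B(1) by (intro sum.mono_neutral_cong_left) auto
    moreover have "q z = (\<Sum>\<alpha>\<in>A \<union> B. (if \<alpha> \<in> B then b \<alpha> else 0) * (\<Prod>j\<in>UNIV. (z $ j) ^ \<alpha> j))"
      unfolding B(2) using A(1) B(1) by (intro sum.mono_neutral_cong_left) auto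
    ultimately show ?thesis
      by (simp only: e_def distrib_right sum.distrib)
  qed
  moreover have "finite (A \<union> B)"
    using A(1) B(1) by simp
  ultimately show ?thesis
    unfolding polys_def by blast
qed

lemma polys_cmult:
  assumes "p \<in> polys"
  shows "(\<lambda>z. k * p z) \<in> polys"
proof -
  obtain A c where A: "finite (A :: ('a \<Rightarrow> nat) set)"
      "p = (\<lambda>z. \<Sum>\<alpha>\<in>A. c \<alpha> * (\<Prod>j\<in>UNIV. (z $ j) ^ \<alpha> j))"
    using assms unfolding polys_def by blast
  have "(\<lambda>z. k * p z) = (\<lambda>z. \<Sum>\<alpha>\<in>A. (k * c \<alpha>) * (\<Prod>j\<in>UNIV. (z $ j) ^ \<alpha> j))"
    by (simp add: A(2) sum_distrib_left mult.assoc)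
  with A(1) show ?thesis
    unfolding polys_def
    by (intro CollectI exI[of _ A] exI[of _ "\<lambda>\<alpha>. k * c \<alpha>"] conjI)
qed

lemma continuous_on_polys:
  assumes "p \<in> polys"
  shows "continuous_on S p"
  using assms unfolding polys_def by (auto intro!: continuous_intros)

lemma restrict_zero_add:
  "restrict_zero \<Omega> (\<lambda>z. p z + q z) = (\<lambda>z. restrict_zero \<Omega> p z + restrict_zero \<Omega> q z)"
  by (auto simp: restrict_zero_def)

lemma restrict_zero_cmult:
  "restrict_zero \<Omega> (\<lambda>z. k * p z) = (\<lambda>z. k * restrict_zero \<Omega> p z)"
  by (auto simp: restrict_zero_def)

section \<open>Extension of functionals from a dense subspace\<close>

lemma function_tvs_cmult_continuous:
  assumes "function_tvs T"
  shows "continuous_map T T (\<lambda>F. \<lambda>z. c * F z)"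
proof -
  have "continuous_map T (prod_topology euclidean T) (\<lambda>F. (c, F))"
    by (simp add: continuous_map_pairedI)
  then show ?thesis
    using assms continuous_map_compose[of T "prod_topology euclidean T" _ T]
    by (fastforce simp: function_tvs_def o_def)
qed

text \<open>Scaling turns the bound on one ball into continuity at the origin, and invariance of the
  metric turns that into uniform continuity on \<open>S\<close>. Since \<complex> is complete,
  \<open>f\<close> then extends continuously to the closure of \<open>S\<close>, and linearity
  passes to the limit.\<close>

lemma linear_functional_on_dense_subspace_extends:
  fixes T :: "('a \<Rightarrow> complex) topology"
  assumes tvs: "function_tvs T"
    and metric: "Metric_space (topspace T) \<rho>"
    and top: "T = Metric_space.mtopology (topspace T) \<rho>"
    and inv: "\<forall>F\<in>topspace T. \<forall>G\<in>topspace T. \<forall>H\<in>topspace T.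
                \<rho> (\<lambda>z. F z + H z) (\<lambda>z. G z + H z) = \<rho> F G"
    and S: "S \<subseteq> topspace T" and dense: "T closure_of S = topspace T"
    and S_add: "\<And>F G. F \<in> S \<Longrightarrow> G \<in> S \<Longrightarrow> (\<lambda>z. F z + G z) \<in> S"
    and S_cmult: "\<And>c F. F \<in> S \<Longrightarrow> (\<lambda>z. c * F z) \<in> S"
    and f_add: "\<And>F G. F \<in> S \<Longrightarrow> G \<in> S \<Longrightarrow> f (\<lambda>z. F z + G z) = f F + f G"
    and f_cmult: "\<And>c F. F \<in> S \<Longrightarrow> f (\<lambda>z. c * F z) = c * f F"
    and r: "0 < r" and bound: "\<And>F. F \<in> S \<Longrightarrow> \<rho> (\<lambda>z. 0) F < r \<Longrightarrow> norm (f F) \<le> 1"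
  obtains L where "continuous_linear_functional T L" "\<And>F. F \<in> S \<Longrightarrow> L F = f F"
proof -
  interpret Metric_space "topspace T" \<rho> by (rule metric)
  let ?m = "metric (topspace T, \<rho>)"
  have mT: "mtopology_of ?m = T"
    using mtopology_of top[symmetric] by simp
  have zero: "(\<lambda>z. 0) \<in> topspace T"
    using tvs by (simp add: function_tvs_def)
  \<comment> \<open>The metric need not be homogeneous, so the ball of radius \<open>r\<close>
    cannot be rescaled by shrinking its radius in proportion. Continuity of multiplication by
    \<open>?k\<close> at the origin supplies \<open>\<delta>\<close> instead. The factor 2 in
    \<open>?k\<close> yields norm at most e/2, hence strictly below \<open>e\<close>.\<close>
  have small: "\<exists>\<delta>>0. \<forall>F\<in>S. \<rho> (\<lambda>z. 0) F < \<delta> \<longrightarrow> norm (f F) < e" if "0 < e" for e :: real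
  proof -
    let ?k = "complex_of_real (2 / e)"
    have "continuous_map mtopology mtopology (\<lambda>F. \<lambda>z. ?k * F z)"
      using function_tvs_cmult_continuous[OF tvs, of ?k] top[symmetric] by simp
    then have "\<exists>\<delta>>0. \<forall>F. F \<in> topspace T \<and> \<rho> (\<lambda>z. 0) F < \<delta> \<longrightarrow> \<rho> (\<lambda>z. ?k * 0) (\<lambda>z. ?k * F z) < r"
      unfolding metric_continuous_map[OF metric] using zero r by blast
    then obtain \<delta> where "0 < \<delta>"
      and \<delta>: "\<And>F. F \<in> topspace T \<Longrightarrow> \<rho> (\<lambda>z. 0) F < \<delta> \<Longrightarrow> \<rho> (\<lambda>z. 0) (\<lambda>z. ?k * F z) < r"
      unfolding mult_zero_right by blast
    have "norm (f F) < e" if "F \<in> S" "\<rho> (\<lambda>z. 0) F < \<delta>" for F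
    proof -
      have "norm (f (\<lambda>z. ?k * F z)) \<le> 1"
        using bound[OF S_cmult] \<delta> that S by blast
      then have "2 / e * norm (f F) \<le> 1"
        using \<open>0 < e\<close> unfolding f_cmult[OF that(1)] norm_mult norm_of_real by simp
      then show ?thesis
        using \<open>0 < e\<close> by (simp add: field_simps)
    qed
    with \<open>0 < \<delta>\<close> show ?thesis by blast
  qed
  have "uniformly_continuous_map (submetric ?m S) euclidean_metric f"
    unfolding uniformly_continuous_map_def
  proof (intro conjI allI impI)
    fix e :: real assume "0 < e"
    then obtain \<delta> where "0 < \<delta>" and \<delta>: "\<And>F. F \<in> S \<Longrightarrow> \<rho> (\<lambda>z. 0) F < \<delta> \<Longrightarrow> norm (f F) < e"
      using small by blast
    have "dist (f G) (f F) < e" if "F \<in> S" "G \<in> S" "\<rho> G F < \<delta>" for F G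
    proof -
      \<comment> \<open>Translating by -F moves the pair \<open>G\<close>, \<open>F\<close> to
        \<open>?D\<close> and the origin at the same distance. Writing -F as a scalar multiple lets
        the closure of \<open>S\<close> and the linearity of \<open>f\<close> apply.\<close>
      let ?N = "\<lambda>z. (-1) * F z"
      let ?D = "\<lambda>z. G z + ?N z"
      have D: "?N \<in> S" "?D \<in> S"
        using that S_cmult S_add by blast+
      have "\<rho> ?D (\<lambda>z. F z + ?N z) = \<rho> G F"
        using that D S by (intro inv[rule_format]) auto
      then have "\<rho> (\<lambda>z. 0) ?D < \<delta>"
        using that(3) by (simp add: commute)
      then have "norm (f ?D) < e"
        using \<delta> D by blast
      then show ?thesis
        using f_add[OF that(2) D(1)] f_cmult[OF that(1), of "-1"] by (simp add: dist_norm)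
    qed
    with \<open>0 < \<delta>\<close> S
    show "\<exists>\<delta>>0. \<forall>x\<in>mspace (submetric ?m S). \<forall>y\<in>mspace (submetric ?m S).
            mdist (submetric ?m S) y x < \<delta> \<longrightarrow> mdist euclidean_metric (f y) (f x) < e"
      by auto
  qed simp
  moreover have "mcomplete_of (euclidean_metric :: complex metric)"
    by (simp add: mcomplete_of_def complete_UNIV)
  ultimately obtain L
    where L: "continuous_map (subtopology T (T closure_of S)) euclidean L"
      and Lf: "\<And>F. F \<in> S \<Longrightarrow> L F = f F"
    using Cauchy_continuous_map_extends_to_continuous_closure_of[of euclidean_metric ?m S f]
      uniformly_imp_Cauchy_continuous_map
    unfolding mT mtopology_of_euclidean by blast
  have L: "continuous_map T euclidean L"
    using L by (simp add: dense)
  have "L (\<lambda>z. F z + G z) = L F + L G" if "F \<in> topspace T" "G \<in> topspace T" for F G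
  proof -
    \<comment> \<open>Both sides are continuous on the product and agree on
      \<open>S \<times> S\<close>, which is dense there.\<close>
    have "(L \<circ> (\<lambda>(F, G). \<lambda>z. F z + G z)) (F, G) = (\<lambda>x. L (fst x) + L (snd x)) (F, G)"
    proof (rule forall_in_closure_of_eq[where g = "\<lambda>x. L (fst x) + L (snd x)"])
      show "(F, G) \<in> prod_topology T T closure_of (S \<times> S)"
        using that by (simp add: closure_of_Times dense)
      show "continuous_map (prod_topology T T) euclidean (L \<circ> (\<lambda>(F, G). \<lambda>z. F z + G z))"
        using tvs L unfolding function_tvs_def by (blast intro: continuous_map_compose)
      show "continuous_map (prod_topology T T) euclidean (\<lambda>x. L (fst x) + L (snd x))"
        by (intro continuous_map_add continuous_map_compose[OF _ L, unfolded o_def]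
            continuous_map_fst continuous_map_snd)
    qed (auto simp: Lf S_add f_add)
    then show ?thesis by simp
  qed
  moreover have "L (\<lambda>z. c * F z) = c * L F" if "F \<in> topspace T" for c F
  proof -
    have "(L \<circ> (\<lambda>F. \<lambda>z. c * F z)) F = c * L F"
    proof (rule forall_in_closure_of_eq[where g = "\<lambda>F. c * L F"])
      show "F \<in> T closure_of S"
        using that by (simp add: dense)
      show "continuous_map T euclidean (L \<circ> (\<lambda>F. \<lambda>z. c * F z))"
        using function_tvs_cmult_continuous[OF tvs] L by (rule continuous_map_compose)
      show "continuous_map T euclidean (\<lambda>F. c * L F)"
        using continuous_map_compose[OF L, of euclidean "\<lambda>x. c * x"]
        by (simp add: o_def continuous_intros)
    qed (auto simp: Lf S_cmult f_cmult)
    then show ?thesis by simp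
  qed
  ultimately have "continuous_linear_functional T L"
    using L by (simp add: continuous_linear_functional_def)
  then show thesis
    using that Lf by blast
qed

section \<open>Points of the maximal domain through bounds on balls\<close>

lemma maximal_domain_iff:
  fixes \<Omega> :: "(complex ^ 'd) set"
  assumes tvs: "function_tvs T"
    and metric: "Metric_space (topspace T) \<rho>"
    and top: "T = Metric_space.mtopology (topspace T) \<rho>"
    and inv: "\<forall>F\<in>topspace T. \<forall>G\<in>topspace T. \<forall>H\<in>topspace T.
                \<rho> (\<lambda>z. F z + H z) (\<lambda>z. G z + H z) = \<rho> F G"
    and P1: "property_P1 \<Omega> T"
  shows "w \<in> maximal_domain \<Omega> T \<longleftrightarrow>
    (\<exists>n. \<forall>p\<in>polys. \<rho> (\<lambda>z. 0) (restrict_zero \<Omega> p) < 1 / real (Suc n) \<longrightarrow> norm (p w) \<le> 1)"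
proof
  interpret Metric_space "topspace T" \<rho> by (rule metric)
  have zero: "(\<lambda>z. 0) \<in> topspace T"
    using tvs by (simp add: function_tvs_def)
  have sub: "restrict_zero \<Omega> ` polys \<subseteq> topspace T"
    and dense: "T closure_of (restrict_zero \<Omega> ` polys) = topspace T"
    using P1 by (auto simp: property_P1_def)
  {
    assume "w \<in> maximal_domain \<Omega> T"
    then obtain L where L: "continuous_linear_functional T L"
      and Lp: "\<And>p. p \<in> polys \<Longrightarrow> L (restrict_zero \<Omega> p) = p w"
      by (auto simp: maximal_domain_def)
    have L0: "L (\<lambda>z. 0) = 0"
    proof -
      have "\<forall>c. \<forall>F\<in>topspace T. L (\<lambda>z. c * F z) = c * L F"
        using L unfolding continuous_linear_functional_def by blast
      from bspec[OF spec[OF this, of 0] zero] show ?thesis by simp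
    qed
    have "continuous_map mtopology Met_TC.mtopology L"
      using L top[symmetric] by (simp add: continuous_linear_functional_def)
    \<comment> \<open>Continuity at the origin with tolerance 1, where \<open>L\<close> vanishes by
      homogeneity; any ball of radius 1/(n+1) below \<open>\<delta>\<close> then serves.\<close>
    then have "\<exists>\<delta>>0. \<forall>F. F \<in> topspace T \<and> \<rho> (\<lambda>z. 0) F < \<delta> \<longrightarrow> dist (L (\<lambda>z. 0)) (L F) < 1"
      unfolding metric_continuous_map[OF Met_TC.Metric_space_axioms] using zero zero_less_one by blast
    then obtain \<delta> where "0 < \<delta>"
      and \<delta>: "\<And>F. F \<in> topspace T \<Longrightarrow> \<rho> (\<lambda>z. 0) F < \<delta> \<Longrightarrow> norm (L F) < 1"
      by (auto simp: L0)
    obtain n where "1 / real (Suc n) < \<delta>"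
      using \<open>0 < \<delta>\<close> nat_approx_posE by blast
    then show "\<exists>n. \<forall>p\<in>polys. \<rho> (\<lambda>z. 0) (restrict_zero \<Omega> p) < 1 / real (Suc n) \<longrightarrow> norm (p w) \<le> 1"
      using \<delta> Lp sub by (metis image_subset_iff less_imp_le less_trans)
  next
    assume "\<exists>n. \<forall>p\<in>polys. \<rho> (\<lambda>z. 0) (restrict_zero \<Omega> p) < 1 / real (Suc n) \<longrightarrow> norm (p w) \<le> 1"
    then obtain r where "0 < r"
      and r: "\<And>p. p \<in> polys \<Longrightarrow> \<rho> (\<lambda>z. 0) (restrict_zero \<Omega> p) < r \<Longrightarrow> norm (p w) \<le> 1"
      by (metis of_nat_0_less_iff zero_less_Suc zero_less_divide_1_iff)
    \<comment> \<open>All multiples of a polynomial vanishing on \<open>\<Omega>\<close> lie in every ball about the origin, so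
       evaluation at \<open>w\<close> depends only on the restriction to \<open>\<Omega>\<close>.\<close>
    have vanish: "p w = 0" if p: "p \<in> polys" and "restrict_zero \<Omega> p = (\<lambda>z. 0)" for p
    proof (rule ccontr)
      assume "p w \<noteq> 0"
      have "\<rho> (\<lambda>z. 0) (restrict_zero \<Omega> (\<lambda>z. (2 / p w) * p z)) < r"
        unfolding restrict_zero_cmult using that(2) zero \<open>0 < r\<close> by simp
      then have "norm ((2 / p w) * p w) \<le> 1"
        using r[OF polys_cmult[OF p]] by blast
      with \<open>p w \<noteq> 0\<close> show False by simp
    qed
    have same: "p w = q w"
      if p: "p \<in> polys" and q: "q \<in> polys" and eq: "restrict_zero \<Omega> p = restrict_zero \<Omega> q" for p q
    proof -
      have "(\<lambda>z. p z + (-1) * q z) \<in> polys"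
        using p q polys_add polys_cmult by blast
      moreover have "restrict_zero \<Omega> (\<lambda>z. p z + (-1) * q z) = (\<lambda>z. 0)"
        unfolding restrict_zero_add restrict_zero_cmult eq by simp
      ultimately have "p w + (-1) * q w = 0"
        by (rule vanish)
      then show ?thesis by simp
    qed
    \<comment> \<open>Evaluation at \<open>w\<close> transported to restrictions: some polynomial
      representing \<open>F\<close> is chosen, and \<open>same\<close> makes the value independent
      of the choice. Outside the restrictions of polynomials the value is arbitrary.\<close>
    define f where "f F = (SOME p. p \<in> polys \<and> restrict_zero \<Omega> p = F) w" for F
    have f: "f (restrict_zero \<Omega> p) = p w" if "p \<in> polys" for p
    proof -
      have "\<exists>q. q \<in> polys \<and> restrict_zero \<Omega> q = restrict_zero \<Omega> p"
        using that by blast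
      from someI_ex[OF this] show ?thesis
        unfolding f_def using same that by blast
    qed
    obtain L where L: "continuous_linear_functional T L"
      "\<And>F. F \<in> restrict_zero \<Omega> ` polys \<Longrightarrow> L F = f F"
    proof (rule linear_functional_on_dense_subspace_extends[OF tvs metric top inv sub dense])
      fix F G :: "complex ^ 'd \<Rightarrow> complex" and c
      assume "F \<in> restrict_zero \<Omega> ` polys"
      then obtain p where p: "p \<in> polys" "F = restrict_zero \<Omega> p" by blast
      show "(\<lambda>z. c * F z) \<in> restrict_zero \<Omega> ` polys" "f (\<lambda>z. c * F z) = c * f F"
        unfolding p(2) restrict_zero_cmult[symmetric]
        using polys_cmult[OF p(1), of c] p(1) f by auto
      show "norm (f F) \<le> 1" if "\<rho> (\<lambda>z. 0) F < r"
        using r p f that by auto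
      assume "G \<in> restrict_zero \<Omega> ` polys"
      then obtain q where q: "q \<in> polys" "G = restrict_zero \<Omega> q" by blast
      show "(\<lambda>z. F z + G z) \<in> restrict_zero \<Omega> ` polys" "f (\<lambda>z. F z + G z) = f F + f G"
        unfolding p(2) q(2) restrict_zero_add[symmetric]
        using polys_add[OF p(1) q(1)] p(1) q(1) f by auto
    qed (use \<open>0 < r\<close> in auto)
    then show "w \<in> maximal_domain \<Omega> T"
      using f by (auto simp: maximal_domain_def)
  }
qed

theorem theorem4p1:
  fixes \<Omega> :: "(complex ^ 'd) set"
    and T :: "(complex ^ 'd \<Rightarrow> complex) topology"
  assumes "open \<Omega>" and "\<Omega> \<noteq> {}"
    and "topspace T \<subseteq> Hol \<Omega>"
    and "function_tvs T"
    and "invariantly_metrizable T"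
    and "property_P1 \<Omega> T"
    and "property_P2 \<Omega> T"
    and "property_P3 T"
  shows "fsigma (maximal_domain \<Omega> T)"
proof -
  obtain \<rho> where \<rho>: "Metric_space (topspace T) \<rho>" "T = Metric_space.mtopology (topspace T) \<rho>"
    "\<forall>F\<in>topspace T. \<forall>G\<in>topspace T. \<forall>H\<in>topspace T.
       \<rho> (\<lambda>z. F z + H z) (\<lambda>z. G z + H z) = \<rho> F G"
    using assms(5) unfolding invariantly_metrizable_def by blast
  \<comment> \<open>The polynomials tested in \<open>K n\<close> are selected by their distance from
    the origin alone, not by \<open>w\<close>. So \<open>K n\<close> is an intersection of closed
    sets, one for each such polynomial.\<close>
  define K where "K n =
    (\<Inter>p\<in>{p \<in> polys. \<rho> (\<lambda>z. 0) (restrict_zero \<Omega> p) < 1 / real (Suc n)}. {w. norm (p w) \<le> 1})" for n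
  have "maximal_domain \<Omega> T = (\<Union>n. K n)"
    using maximal_domain_iff[OF assms(4) \<rho> assms(6)] unfolding K_def by blast
  moreover have "closed (K n)" for n
    unfolding K_def
    by (intro closed_INT ballI closed_Collect_le continuous_on_norm continuous_on_const
        continuous_on_polys) auto
  ultimately show ?thesis
    using fsigma.intros[of K] by simp
qed

end
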